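(* Let $W$ be the R1-reduced occurrence word of a classical knot shadow $G$ with $s>3$ crossings, and let $A_G$ be its arc-crossing state graph. For each $\varepsilon\in\mathbb F_2$, the strongly connected components (SCCs) of $A_G$ contained in $V_\varepsilon$ are $N_\varepsilon$ and the singletons $\{\alpha\}$, $\alpha\in S_\varepsilon$. In the condensation digraph $\operatorname{SC}(A_G)$, $N_\varepsilon$ is the unique sink in its parity class, and every $\{\alpha\}$ with $\alpha\in S_\varepsilon$ is a source whose only arrow enters $N_\varepsilon$. Altogether (over both $\varepsilon=0,1$) there are at most two singleton source SCCs $\{\alpha\}$, $\alpha\in S_0\cup S_1$.
   Context: Shadow. A classical knot shadow is the image $G\subset\mathbb R^2$ of a generic immersion $\gamma:S^1\to\mathbb R^2$ of a single circle whose only singularities are finitely many transverse double points, called crossings, denoted $x_0,\dots,x_{s-1}$ (crossing $x_i$ is also referred to by its label $i$). Each crossing $x_i$ has exactly two preimages in $S^1$, called its occurrences. Orient $S^1$ and fix a basepoint that is not an occurrence; traversing $S^1$ from it, the first-met preimage of $x_i$ is $p_i^0$ and the other is $p_i^1$. Reading the labels of the $2s$ occurrences in order gives the cyclic occurrence word $W=w_0\cdots w_{2s-1}$, in which every label occurs twice. $W$ (or $G$) is R1-reduced if no two cyclically adjacent letters of $W$ are equal. States. A state $\alpha$ is a choice, for each crossing, of one of its two occurrences as the undercrossing occurrence; it is identified with $(\alpha_0,\dots,\alpha_{s-1})\in\mathbb F_2^s$, where $\alpha_i=0$ if $p_i^0$ is chosen and $\alpha_i=1$ if $p_i^1$ is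 chosen. $\operatorname{Sel}(\alpha)\subset S^1$ is the set of the $s$ chosen occurrences. An arc of $\alpha$ is an oriented segment of $S^1$ from one point of $\operatorname{Sel}(\alpha)$ to the next in cyclic order; $\alpha$ has $s$ arcs. State graph. $e_i$ is the $i$-th standard basis vector of $\mathbb F_2^s$. The arc-crossing state graph $A_G$ is the digraph with vertex set $\mathbb F_2^s$ and exactly the arrows $\alpha\to\alpha+e_i+e_j$, for each state $\alpha$ and each arc of $\alpha$ whose endpoints are occurrences of crossings $i$ and $j$. Parity and sources. $p(\alpha)=\alpha_0+\cdots+\alpha_{s-1}\in\mathbb F_2$; for $\varepsilon\in\mathbb F_2$, $V_\varepsilon=\{\alpha\in\mathbb F_2^s:p(\alpha)=\varepsilon\}$ (a parity class; no arrow of $A_G$ joins $V_0$ and $V_1$), $S_\varepsilon=\{\alpha\in V_\varepsilon:\deg^-(\alpha)=0\}$ where $\deg^-$ is indegree in $A_G$, and $N_\varepsilon=V_\varepsilon\setminus S_\varepsilon$. Condensation. $\operatorname{SC}(A_G)$ is the acyclic digraph obtained from $A_G$ by contracting each SCC to a vertex and deleting parallel arrows (and loops). A source of a digraph is a vertex of indegree zero; a sink is a vertex of outdegree zero. *)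

theory Defs
  imports "HOL-Analysis.Analysis" "HOL-Library.Z2" "Graph_Theory.Graph_Theory"
begin

text \<open>
  The circle is \<open>\<real>/\<int>\<close>: a closed curve is a 1-periodic map on the reals, and a point of the
  circle is represented in a half-open window of length 1.
\<close>

definition crossings :: "(real \<Rightarrow> real ^ 2) \<Rightarrow> (real ^ 2) set" where
  "crossings \<gamma> = {q. \<exists>t\<in>{0..<1}. \<exists>u\<in>{0..<1}. t \<noteq> u \<and> \<gamma> t = q \<and> \<gamma> u = q}"

definition generic_immersion :: "(real \<Rightarrow> real ^ 2) \<Rightarrow> bool" where
  "generic_immersion \<gamma> \<longleftrightarrow>
     (\<forall>t. \<gamma> (t + 1) = \<gamma> t) \<and>
     \<gamma> C1_differentiable_on UNIV \<and>
     (\<forall>t. vector_derivative \<gamma> (at t) \<noteq> 0) \<and>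
     finite (crossings \<gamma>) \<and>
     (\<forall>q\<in>crossings \<gamma>. card {t\<in>{0..<1}. \<gamma> t = q} = 2) \<and>
     (\<forall>t\<in>{0..<1}. \<forall>u\<in>{0..<1}. t \<noteq> u \<and> \<gamma> t = \<gamma> u \<longrightarrow>
        span {vector_derivative \<gamma> (at t), vector_derivative \<gamma> (at u)} = UNIV)"

text \<open>
  The crossings are labelled by a finite type \<open>'n\<close> through a bijection
  \<open>x :: 'n \<Rightarrow> real ^ 2\<close> onto \<open>crossings \<gamma>\<close>, so the number of crossings is \<open>CARD('n)\<close>.
  The traversal starts at the basepoint \<open>b\<close> and runs through the window \<open>{b..<b+1}\<close>.
\<close>

definition occurrence_word ::
    "(real \<Rightarrow> real ^ 2) \<Rightarrow> real \<Rightarrow> ('n::finite \<Rightarrow> real ^ 2) \<Rightarrow> 'n list" where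
  "occurrence_word \<gamma> b x =
     map (\<lambda>t. inv x (\<gamma> t)) (sorted_list_of_set {t\<in>{b..<b+1}. \<gamma> t \<in> crossings \<gamma>})"

definition R1_reduced :: "'n list \<Rightarrow> bool" where
  "R1_reduced w \<longleftrightarrow> (\<forall>k<length w. w ! k \<noteq> w ! (Suc k mod length w))"

definition occurrence :: "(real \<Rightarrow> real ^ 2) \<Rightarrow> real \<Rightarrow> real ^ 2 \<Rightarrow> bit \<Rightarrow> real" where
  "occurrence \<gamma> b q k =
     (let P = {t\<in>{b..<b+1}. \<gamma> t = q} in if k = 0 then Min P else Max P)"

type_synonym 'n state = "bit ^ 'n"

definition Sel ::
    "(real \<Rightarrow> real ^ 2) \<Rightarrow> real \<Rightarrow> ('n::finite \<Rightarrow> real ^ 2) \<Rightarrow> 'n state \<Rightarrow> real set" where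
  "Sel \<gamma> b x \<alpha> = range (\<lambda>i. occurrence \<gamma> b (x i) (\<alpha> $ i))"

text \<open>The next point of a finite set in cyclic order: after the largest one comes the smallest.\<close>

definition cyclic_next :: "real set \<Rightarrow> real \<Rightarrow> real" where
  "cyclic_next P t = (if \<exists>u\<in>P. t < u then Min {u\<in>P. t < u} else Min P)"

text \<open>An arc of a state is recorded by its pair of start point and end point.\<close>

definition state_arcs ::
    "(real \<Rightarrow> real ^ 2) \<Rightarrow> real \<Rightarrow> ('n::finite \<Rightarrow> real ^ 2) \<Rightarrow> 'n state \<Rightarrow> (real \<times> real) set" where
  "state_arcs \<gamma> b x \<alpha> = {(t, cyclic_next (Sel \<gamma> b x \<alpha>) t) | t. t \<in> Sel \<gamma> b x \<alpha>}"

definition state_graph ::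
    "(real \<Rightarrow> real ^ 2) \<Rightarrow> real \<Rightarrow> ('n::finite \<Rightarrow> real ^ 2) \<Rightarrow> 'n state pair_pre_digraph" where
  "state_graph \<gamma> b x =
     \<lparr> pverts = UNIV,
       parcs = {(\<alpha>, \<alpha> + axis i 1 + axis j 1) | \<alpha> i j.
                  \<exists>(t, u)\<in>state_arcs \<gamma> b x \<alpha>. \<gamma> t = x i \<and> \<gamma> u = x j} \<rparr>"

definition parity :: "'n::finite state \<Rightarrow> bit" where
  "parity \<alpha> = (\<Sum>i\<in>UNIV. \<alpha> $ i)"

definition parity_class :: "bit \<Rightarrow> 'n::finite state set" where
  "parity_class \<epsilon> = {\<alpha>. parity \<alpha> = \<epsilon>}"

definition source_states :: "'n::finite state pair_pre_digraph \<Rightarrow> bit \<Rightarrow> 'n state set" where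
  "source_states A \<epsilon> = {\<alpha> \<in> parity_class \<epsilon>. in_degree A \<alpha> = 0}"

definition nonsource_states :: "'n::finite state pair_pre_digraph \<Rightarrow> bit \<Rightarrow> 'n state set" where
  "nonsource_states A \<epsilon> = parity_class \<epsilon> - source_states A \<epsilon>"

definition condensation :: "'a pair_pre_digraph \<Rightarrow> 'a set pair_pre_digraph" where
  "condensation A =
     \<lparr> pverts = pre_digraph.sccs_verts A,
       parcs = {(C, D). C \<in> pre_digraph.sccs_verts A \<and> D \<in> pre_digraph.sccs_verts A \<and> C \<noteq> D \<and>
                        (\<exists>u\<in>C. \<exists>v\<in>D. (u, v) \<in> parcs A)} \<rparr>"

end

theory Submission
  imports Defs
begin

text \<open>
  Geometry enters only through the occurrence word. Encode an occurrence of crossing \<open>i\<close> as a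
  pair \<open>(i, k)\<close> with \<open>k\<close> a bit; the cyclic order of the occurrences is then a permutation
  \<open>nxt\<close> of these pairs consisting of a single cycle, and a state \<open>\<alpha>\<close> selects the pairs
  \<open>(i, \<alpha> $ i)\<close>, so it selects exactly one of the two occurrences of every crossing. An arrow
  changes a state at the two ends of an arc. Two kinds of arcs suffice: those joining neighbouring
  occurrences, pattern \<open>+ +\<close> with \<open>+\<close> for selected, and those skipping a single unselected one,
  pattern \<open>+ - +\<close>. The heart of the matter is the following claim: a nonempty set \<open>C\<close>
  of states that is closed under these two kinds of arrows contains every state of the same parity that
  has a predecessor \<open>\<delta>\<close>, provided \<open>C\<close> does not lose that state once it contains \<open>\<delta>\<close>
  (\<open>contains_states_with_predecessor\<close>). Applied to the set of states reachable from a given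
  one, it says that every state reaches every non-source of its parity, and the description of the
  strongly connected components and of the condensation is a formal consequence
  (\<open>scc_structure\<close>).

  The claim is proved in three steps. First, as many occurrences are selected as are not, so around the
  circle the number of neighbouring pairs \<open>+ +\<close> equals that of pairs \<open>- -\<close>. The former
  are the \<open>+ +\<close> moves leaving a state and the latter are the \<open>+ +\<close> moves entering it: the
  digraph of these moves is Eulerian. A finite set of vertices of an Eulerian digraph that no arrow
  leaves is entered by none, hence \<open>C\<close> is also closed under the reversed moves
  (\<open>pair_flip_reversible\<close>).

  Secondly, within \<open>C\<close> the letters at two neighbouring positions may therefore be changed together
  whenever their bits are different, or whenever they are equal, according to the positions. Such a
  permission composes along the word like a sign (\<open>exchangeable_trans\<close>), so any two letters
  carry a permission with at least one sign. If some pair carries both signs, all pairs do, and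
  \<open>C\<close> is a whole parity class. Otherwise the signs are balanced and there is a state \<open>g\<close>,
  necessarily alternating around the circle, such that the letters where a state disagrees with
  \<open>g\<close> behave like indistinguishable particles that may be moved to any free letters
  (\<open>balanced_or_complete\<close>).

  Thirdly, in the balanced case only the number of disagreements with \<open>g\<close> matters, and a \<open>+ - +\<close>
  arrow changes it by two. All numbers of the right parity strictly between the two extremes are thus
  attained in \<open>C\<close> (\<open>balanced_covers\<close>); the two extreme states, \<open>g\<close> and its
  complement, are recovered from a predecessor, which is not extreme itself.

  Finally, a state with a pattern \<open>- -\<close> has a predecessor. A source therefore has no such pattern,
  by the count above no pattern \<open>+ +\<close> either, and it alternates around the circle. There are only two
  alternating choices, whence at most two sources (\<open>card_alternating_le\<close>).
\<close>

section \<open>States, parity and crossing changes\<close>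

instance bit :: finite
proof
  have "(UNIV :: bit set) = {0, 1}"
    using bit_not_zero_iff by blast
  moreover have "finite {0, 1 :: bit}"
    by simp
  ultimately show "finite (UNIV :: bit set)"
    by (simp only:)
qed

text \<open>
  The state obtained from \<open>\<alpha>\<close> by crossing changes at \<open>i\<close> and \<open>j\<close>. For \<open>i = j\<close> this changes
  the single crossing \<open>i\<close>, unlike adding \<open>axis i 1\<close> twice.
\<close>

definition flip :: "'n::finite state \<Rightarrow> 'n \<Rightarrow> 'n \<Rightarrow> 'n state" where
  "flip \<alpha> i j = (\<chi> k. if k = i \<or> k = j then (if \<alpha> $ k = 0 then 1 else 0) else \<alpha> $ k)"

lemma bit_add_iff: "a + b = (if a = b then 0 else 1)" for a b :: bit
  by (cases a; cases b) auto

lemma bit_eq_via: "(a = b) = ((c = a) = (c = b))" for a b c :: bit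
  by (cases a; cases b; cases c) simp_all

lemma bit_eq_swap: "((a = b) = (c = d)) = ((a = c) = (b = d))" for a b c d :: bit
  by (cases a; cases b; cases c; cases d) simp_all

lemma flip_eq_add_axis:
  assumes "i \<noteq> j"
  shows "\<alpha> + axis i 1 + axis j 1 = flip \<alpha> i j"
  using assms by (auto simp: vec_eq_iff flip_def axis_def bit_add_iff)

lemma flip_commute: "flip \<alpha> i j = flip \<alpha> j i"
  by (auto simp: flip_def vec_eq_iff)

lemma flip_flip [simp]: "flip (flip \<alpha> i j) i j = \<alpha>"
  by (auto simp: flip_def vec_eq_iff)

lemma flip_flip_common:
  assumes "i \<noteq> j" "j \<noteq> k" "i \<noteq> k"
  shows "flip (flip \<alpha> i j) j k = flip \<alpha> i k"
  using assms by (auto simp: flip_def vec_eq_iff)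

definition disagreement :: "'n::finite state \<Rightarrow> 'n state \<Rightarrow> 'n set" where
  "disagreement \<alpha> \<beta> = {k. \<alpha> $ k \<noteq> \<beta> $ k}"

lemma disagreement_empty_iff: "disagreement \<alpha> \<beta> = {} \<longleftrightarrow> \<alpha> = \<beta>"
  by (auto simp: disagreement_def vec_eq_iff)

lemma of_nat_bit_eq_iff: "(of_nat m = (of_nat n :: bit)) \<longleftrightarrow> (even m = even n)"
proof -
  have "of_nat k = (if even k then 0 else 1 :: bit)" for k :: nat
    by (induction k) (auto simp: bit_add_iff)
  then show ?thesis by simp
qed

lemma parity_add_parity: "parity \<alpha> + parity \<beta> = of_nat (card (disagreement \<alpha> \<beta>))"
proof -
  have "parity \<alpha> + parity \<beta> = (\<Sum>k\<in>UNIV. \<alpha> $ k + \<beta> $ k)"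
    by (simp add: parity_def sum.distrib del: add_bit_eq_xor)
  also have "\<dots> = (\<Sum>k\<in>UNIV. if k \<in> disagreement \<alpha> \<beta> then 1 else 0)"
    by (rule sum.cong) (auto simp: disagreement_def bit_add_iff)
  also have "\<dots> = of_nat (card (disagreement \<alpha> \<beta>))"
    by (simp add: sum.If_cases)
  finally show ?thesis .
qed

lemma parity_eq_iff: "parity \<alpha> = parity \<beta> \<longleftrightarrow> even (card (disagreement \<alpha> \<beta>))"
proof -
  have "parity \<alpha> = parity \<beta> \<longleftrightarrow> parity \<alpha> + parity \<beta> = of_nat 0"
    by (cases "parity \<alpha>"; cases "parity \<beta>") auto
  then show ?thesis
    unfolding parity_add_parity of_nat_bit_eq_iff by simp
qed

lemma parity_eq_iff_even_disagreement:
  "parity \<alpha> = parity \<beta> \<longleftrightarrow>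
     (even (card (disagreement \<alpha> g)) = even (card (disagreement \<beta> g)))"
proof -
  have "parity \<alpha> = parity \<beta> \<longleftrightarrow> parity \<alpha> + parity g = parity \<beta> + parity g"
    by (simp del: add_bit_eq_xor)
  then show ?thesis
    unfolding parity_add_parity of_nat_bit_eq_iff .
qed

lemma disagreement_flip:
  assumes "i \<noteq> j"
  shows "disagreement (flip \<alpha> i j) \<beta> = sym_diff (disagreement \<alpha> \<beta>) {i, j}"
  by (auto simp: disagreement_def flip_def)

lemma disagreement_flip_self: "i \<noteq> j \<Longrightarrow> disagreement (flip \<alpha> i j) \<alpha> = {i, j}"
  by (auto simp: disagreement_def flip_def)

lemma parity_flip: "i \<noteq> j \<Longrightarrow> parity (flip \<alpha> i j) = parity \<alpha>"
  by (simp add: parity_eq_iff disagreement_flip_self)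

text \<open>
  Two states of equal parity disagree at an even number of crossings, and changing two of these
  brings them closer to each other.
\<close>

lemma flip_closed_parity_class:
  assumes closed: "\<And>\<alpha> i j. \<alpha> \<in> C \<Longrightarrow> i \<noteq> j \<Longrightarrow> flip \<alpha> i j \<in> C"
    and "\<alpha> \<in> C" "parity \<alpha> = parity \<beta>"
  shows "\<beta> \<in> C"
  using assms(2,3)
proof (induction "card (disagreement \<alpha> \<beta>)" arbitrary: \<alpha> rule: less_induct)
  case less
  show ?case
  proof (cases "\<alpha> = \<beta>")
    case True
    then show ?thesis using less.prems by simp
  next
    case False
    let ?D = "disagreement \<alpha> \<beta>"
    from False have "card ?D \<noteq> 0" by (simp add: disagreement_empty_iff)
    moreover have "even (card ?D)" using less.prems by (simp add: parity_eq_iff)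
    ultimately have "2 \<le> card ?D" by presburger
    then obtain i j where ij: "i \<in> ?D" "j \<in> ?D" "i \<noteq> j"
      by (meson card_2_iff' obtain_subset_with_card_n subsetD)
    then have "disagreement (flip \<alpha> i j) \<beta> = ?D - {i, j}"
      by (auto simp: disagreement_flip)
    then have "card (disagreement (flip \<alpha> i j) \<beta>) < card ?D"
      using ij by (metis Diff_subset finite psubsetI psubset_card_mono Diff_iff insertI1)
    with ij show ?thesis
      using less closed parity_flip by metis
  qed
qed

text \<open>
  Regard the crossings where a state disagrees with \<open>g\<close> as particles. The closure hypothesis
  allows exactly the moves of one particle to a free crossing, because
  \<open>(\<alpha> $ i \<noteq> \<alpha> $ j) = (g $ i = g $ j)\<close> says that one of \<open>i\<close>, \<open>j\<close> carries a particle and the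
  other one does not. Such moves realise every configuration with the given number of particles.
\<close>

lemma exchange_closed_level:
  assumes closed: "\<And>\<alpha> i j. \<alpha> \<in> C \<Longrightarrow> i \<noteq> j \<Longrightarrow>
      (\<alpha> $ i \<noteq> \<alpha> $ j) = (g $ i = g $ j) \<Longrightarrow> flip \<alpha> i j \<in> C"
    and "\<alpha> \<in> C" "card (disagreement \<alpha> g) = card (disagreement \<beta> g)"
  shows "\<beta> \<in> C"
  using assms(2,3)
proof (induction "card (disagreement \<alpha> \<beta>)" arbitrary: \<alpha> rule: less_induct)
  case less
  let ?A = "disagreement \<alpha> g" and ?B = "disagreement \<beta> g"
  show ?case
  proof (cases "?A = ?B")
    case True
    have "\<alpha> $ k = \<beta> $ k" for k
    proof -
      have "(\<alpha> $ k = g $ k) = (\<beta> $ k = g $ k)" using True by (auto simp: disagreement_def)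
      then show ?thesis by (metis bit_not_zero_iff)
    qed
    then have "\<alpha> = \<beta>" by (simp add: vec_eq_iff)
    then show ?thesis using less.prems by simp
  next
    case False
    obtain i where i: "i \<in> ?A" "i \<notin> ?B"
      using False less.prems(2) card_subset_eq[of ?B ?A] by auto
    obtain j where j: "j \<in> ?B" "j \<notin> ?A"
      using False less.prems(2) card_subset_eq[of ?A ?B] by auto
    have ne: "i \<noteq> j" using i j by auto
    have "flip \<alpha> i j \<in> C"
      using closed[OF less.prems(1) ne] i j unfolding disagreement_def mem_Collect_eq
      by (metis bit_not_zero_iff)
    moreover have "card (disagreement (flip \<alpha> i j) \<beta>) < card (disagreement \<alpha> \<beta>)"
    proof (rule psubset_card_mono)
      show "disagreement (flip \<alpha> i j) \<beta> \<subset> disagreement \<alpha> \<beta>"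
        using i j ne by (auto simp: disagreement_def flip_def split: if_splits)
    qed simp
    moreover have "card (disagreement (flip \<alpha> i j) g) = card ?B"
    proof -
      have "disagreement (flip \<alpha> i j) g = insert j (?A - {i})"
        using i j ne by (auto simp: disagreement_flip)
      then show ?thesis
        using i j less.prems(2) card_Suc_Diff1[OF _ i(1)] by simp
    qed
    ultimately show ?thesis using less.hyps by blast
  qed
qed

section \<open>Circular double occurrence words\<close>

definition selected :: "'n::finite state \<Rightarrow> 'n \<times> bit \<Rightarrow> bool" where
  "selected \<alpha> p \<longleftrightarrow> \<alpha> $ fst p = snd p"

lemma selected_flip:
  "selected (flip \<alpha> i j) p \<longleftrightarrow> (if fst p = i \<or> fst p = j then \<not> selected \<alpha> p else selected \<alpha> p)"
  by (auto simp: selected_def flip_def)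

lemma selected_inject: "selected \<alpha> = selected \<beta> \<Longrightarrow> \<alpha> = \<beta>"
  by (auto simp: selected_def fun_eq_iff vec_eq_iff)

lemma card_selected: "card {p. selected \<alpha> p} = card {p. \<not> selected \<alpha> p}"
proof (rule bij_betw_same_card)
  let ?f = "\<lambda>p :: 'a \<times> bit. (fst p, if snd p = 0 then 1 else 0)"
  show "bij_betw ?f {p. selected \<alpha> p} {p. \<not> selected \<alpha> p}"
    by (rule bij_betw_byWitness[where f' = ?f]) (auto simp: selected_def split: if_splits)
qed

text \<open>
  A double occurrence word read on a circle: \<open>nxt\<close> maps each occurrence to the one that follows it,
  and being a single cycle is expressed by the absence of proper invariant subsets. The last
  assumption is R1-reducedness.
\<close>

locale cyclic_word =
  fixes nxt :: "'n::finite \<times> bit \<Rightarrow> 'n \<times> bit"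
  assumes single_cycle: "p \<in> Q \<Longrightarrow> (\<And>q. q \<in> Q \<Longrightarrow> nxt q \<in> Q) \<Longrightarrow> Q = UNIV"
    and reduced: "fst (nxt p) \<noteq> fst p"
begin

lemma bij_nxt: "bij nxt"
proof -
  have "range nxt = UNIV"
    by (rule single_cycle[of "nxt undefined"]) auto
  then show ?thesis
    by (simp add: bij_def finite_UNIV_surj_inj)
qed

abbreviation flip_at :: "'n state \<Rightarrow> 'n \<times> bit \<Rightarrow> 'n state" where
  "flip_at \<alpha> p \<equiv> flip \<alpha> (fst p) (fst (nxt p))"

text \<open>
  Both sides differ by the number of patterns \<open>- +\<close> from the number of selected, respectively
  unselected, occurrences, and these two numbers agree.
\<close>

lemma card_selected_pairs:
  "card {p. selected \<alpha> p \<and> selected \<alpha> (nxt p)} = card {p. \<not> selected \<alpha> p \<and> \<not> selected \<alpha> (nxt p)}"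
proof -
  let ?S = "{p. selected \<alpha> p}"
  let ?T = "{p. \<not> selected \<alpha> p \<and> selected \<alpha> (nxt p)}"
  have "nxt ` {p. selected \<alpha> (nxt p)} = ?S"
    using bij_nxt by (auto simp: bij_def) (metis imageI mem_Collect_eq surj_def)
  then have "card ?S = card {p. selected \<alpha> (nxt p)}"
    using card_image[OF inj_on_subset[OF bij_is_inj[OF bij_nxt] subset_UNIV]] by metis
  also have "{p. selected \<alpha> (nxt p)} = {p. selected \<alpha> p \<and> selected \<alpha> (nxt p)} \<union> ?T"
    by auto
  also have "card \<dots> = card {p. selected \<alpha> p \<and> selected \<alpha> (nxt p)} + card ?T"
    by (rule card_Un_disjoint) auto
  finally have 1: "card ?S = card {p. selected \<alpha> p \<and> selected \<alpha> (nxt p)} + card ?T" .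
  have "{p. \<not> selected \<alpha> p} = {p. \<not> selected \<alpha> p \<and> \<not> selected \<alpha> (nxt p)} \<union> ?T"
    by auto
  also have "card \<dots> = card {p. \<not> selected \<alpha> p \<and> \<not> selected \<alpha> (nxt p)} + card ?T"
    by (rule card_Un_disjoint) auto
  finally show ?thesis
    using 1 card_selected[of \<alpha>] by simp
qed

lemma no_unselected_pair_alternates:
  assumes "\<And>p. selected \<alpha> p \<or> selected \<alpha> (nxt p)"
  shows "selected \<alpha> (nxt p) \<longleftrightarrow> \<not> selected \<alpha> p"
proof -
  have "card {p. selected \<alpha> p \<and> selected \<alpha> (nxt p)} = 0"
    unfolding card_selected_pairs using assms by simp
  then have "{p. selected \<alpha> p \<and> selected \<alpha> (nxt p)} = {}"
    by simp
  then show ?thesis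
    using assms by blast
qed

text \<open>
  By the count of pairs, a state without a pattern \<open>- -\<close> alternates, so that its value at one
  occurrence determines it.
\<close>

lemma card_alternating_le:
  "card {\<alpha>. \<forall>p. selected \<alpha> p \<or> selected \<alpha> (nxt p)} \<le> 2" (is "card ?X \<le> 2")
proof -
  obtain p :: "'n \<times> bit" where True
    by simp
  have "inj_on (\<lambda>\<alpha>. selected \<alpha> p) ?X"
  proof (rule inj_onI)
    fix \<alpha> \<beta>
    assume "\<alpha> \<in> ?X" "\<beta> \<in> ?X" and eq: "selected \<alpha> p = selected \<beta> p"
    then have "selected \<alpha> (nxt q) \<longleftrightarrow> \<not> selected \<alpha> q" "selected \<beta> (nxt q) \<longleftrightarrow> \<not> selected \<beta> q" for q
      using no_unselected_pair_alternates by blast+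
    then have "{q. selected \<alpha> q = selected \<beta> q} = UNIV"
      using eq by (intro single_cycle[of p]) auto
    then show "\<alpha> = \<beta>"
      by (intro selected_inject) auto
  qed
  then have "card ?X \<le> card (UNIV :: bool set)"
    by (rule card_inj_on_le) auto
  then show ?thesis
    by simp
qed

lemma selected_flip_at:
  "selected (flip_at \<alpha> p) p \<longleftrightarrow> \<not> selected \<alpha> p"
  "selected (flip_at \<alpha> p) (nxt p) \<longleftrightarrow> \<not> selected \<alpha> (nxt p)"
  by (auto simp: selected_flip)

text \<open>
  The Eulerian property at work: the \<open>+ +\<close> moves that start in \<open>C\<close> are at the same time moves that end
  in \<open>C\<close>, and by \<open>card_selected_pairs\<close> there are equally many of both, so every move that ends in
  \<open>C\<close> also starts there.
\<close>

lemma pair_flip_reversible: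
  assumes closed: "\<And>\<alpha> p. \<alpha> \<in> C \<Longrightarrow> selected \<alpha> p \<Longrightarrow> selected \<alpha> (nxt p) \<Longrightarrow> flip_at \<alpha> p \<in> C"
    and "\<beta> \<in> C" "\<not> selected \<beta> p" "\<not> selected \<beta> (nxt p)"
  shows "flip_at \<beta> p \<in> C"
proof -
  let ?out = "SIGMA \<alpha>:C. {p. selected \<alpha> p \<and> selected \<alpha> (nxt p)}"
  let ?in = "SIGMA \<alpha>:C. {p. \<not> selected \<alpha> p \<and> \<not> selected \<alpha> (nxt p)}"
  let ?f = "\<lambda>(\<alpha>, p). (flip_at \<alpha> p, p)"
  \<comment> \<open>A move from \<open>C\<close> along \<open>p\<close>, seen from its target.\<close>
  have inj: "inj_on ?f ?out"
  proof (rule inj_onI, clarsimp)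
    fix \<alpha> \<beta> :: "'n state" and i k
    assume "flip \<alpha> i (fst (nxt (i, k))) = flip \<beta> i (fst (nxt (i, k)))"
    then show "\<alpha> = \<beta>" by (metis flip_flip)
  qed
  have sub: "?f ` ?out \<subseteq> ?in"
    using closed selected_flip_at by auto
  have "card ?in = card ?out"
    by (simp add: card_selected_pairs)
  then have "?f ` ?out = ?in"
    using sub card_image[OF inj] by (intro card_subset_eq) auto
  moreover have "(\<beta>, p) \<in> ?in"
    using assms by auto
  ultimately have "(\<beta>, p) \<in> ?f ` ?out"
    by simp
  then obtain \<alpha> where "\<alpha> \<in> C" "\<beta> = flip_at \<alpha> p"
    by auto
  then show ?thesis
    by simp
qed

end

section \<open>Signed exchanges of letters\<close>

text \<open>
  The permission to change \<open>i\<close> and \<open>j\<close> together inside \<open>C\<close>, with a sign \<open>d\<close>: it is granted to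
  states with different bits at \<open>i\<close> and \<open>j\<close> if \<open>d\<close> holds (an exchange of the two bits), and to
  states with equal bits if \<open>d\<close> fails.
\<close>

definition exchangeable :: "'n::finite state set \<Rightarrow> bool \<Rightarrow> 'n \<Rightarrow> 'n \<Rightarrow> bool" where
  "exchangeable C d i j \<longleftrightarrow> (\<forall>\<alpha>\<in>C. (\<alpha> $ i \<noteq> \<alpha> $ j) = d \<longrightarrow> flip \<alpha> i j \<in> C)"

lemma exchangeable_sym: "exchangeable C d i j \<Longrightarrow> exchangeable C d j i"
  by (simp add: exchangeable_def flip_commute) metis

text \<open>
  The conjugation \<open>(i k) = (i j) (j k) (i j)\<close> of transpositions in a signed version. For a state that
  qualifies for the pair \<open>i\<close>, \<open>k\<close>, exactly one of the two given permissions is applicable, and after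
  using it the other one becomes applicable; the middle letter \<open>j\<close> is changed twice.
\<close>

lemma exchangeable_trans:
  assumes "exchangeable C d i j" "exchangeable C e j k" "i \<noteq> j" "j \<noteq> k" "i \<noteq> k"
  shows "exchangeable C (d = e) i k"
  unfolding exchangeable_def
proof (intro ballI impI)
  fix \<alpha>
  assume "\<alpha> \<in> C" and ik: "(\<alpha> $ i \<noteq> \<alpha> $ k) = (d = e)"
  show "flip \<alpha> i k \<in> C"
  proof (cases "(\<alpha> $ i \<noteq> \<alpha> $ j) = d")
    case True
    then have "flip \<alpha> i j \<in> C"
      using assms(1) \<open>\<alpha> \<in> C\<close> by (simp add: exchangeable_def)
    moreover have "(flip \<alpha> i j $ j \<noteq> flip \<alpha> i j $ k) = e"
      using True ik assms(3-5) by (cases "\<alpha> $ i"; cases "\<alpha> $ j"; cases "\<alpha> $ k") (auto simp: flip_def)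
    ultimately have "flip (flip \<alpha> i j) j k \<in> C"
      using assms(2) unfolding exchangeable_def by blast
    then show ?thesis
      using assms(3-5) by (simp add: flip_flip_common)
  next
    case False
    then have "(\<alpha> $ j \<noteq> \<alpha> $ k) = e"
      using ik by (cases "\<alpha> $ i"; cases "\<alpha> $ j"; cases "\<alpha> $ k") auto
    then have "flip \<alpha> j k \<in> C"
      using assms(2) \<open>\<alpha> \<in> C\<close> by (simp add: exchangeable_def)
    moreover have "(flip \<alpha> j k $ i \<noteq> flip \<alpha> j k $ j) = d"
      using False assms(3-5) by (cases "\<alpha> $ i"; cases "\<alpha> $ j"; cases "\<alpha> $ k") (auto simp: flip_def)
    ultimately have "flip (flip \<alpha> j k) i j \<in> C"
      using assms(1) unfolding exchangeable_def by blast
    moreover have "flip (flip \<alpha> j k) i j = flip \<alpha> i k"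
      using flip_flip_common[of k j i \<alpha>] assms(3-5) by (metis flip_commute)
    ultimately show ?thesis
      by simp
  qed
qed

text \<open>
  Composing a pair that carries both signs with any other pair gives both signs again.
\<close>

lemma exchangeable_both_spreads:
  assumes some: "\<And>k l. k \<noteq> l \<Longrightarrow> \<exists>d. exchangeable C d k l"
    and both: "\<And>d. exchangeable C d i j" and "i \<noteq> j" and "k \<noteq> l"
  shows "exchangeable C d k l"
proof -
  \<comment> \<open>From the pair \<open>a\<close>, \<open>b\<close> with both signs to any other pair that contains \<open>a\<close>.\<close>
  have spread: "exchangeable C d a c"
    if "\<And>d. exchangeable C d a b" "a \<noteq> b" "a \<noteq> c" for a b c d
  proof (cases "b = c")
    case False
    then obtain e where "exchangeable C e b c"
      using some by blast
    then have "exchangeable C ((d = e) = e) a c"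
      using exchangeable_trans that False by metis
    moreover have "((d = e) = e) = d"
      by auto
    ultimately show ?thesis
      by simp
  qed (use that in simp)
  show ?thesis
  proof (cases "i = k")
    case True
    then show ?thesis using spread[OF both] assms(3,4) by blast
  next
    case False
    then have "exchangeable C d k i" for d
      using spread[OF both] assms(3) exchangeable_sym by blast
    then show ?thesis
      using spread False assms(4) by metis
  qed
qed

section \<open>Closed sets of states\<close>

lemma card_complement: "card (- X) = CARD('a) - card X" for X :: "'a::finite set"
  unfolding Compl_eq_Diff_UNIV by (rule card_Diff_subset) simp_all

definition negate :: "'n::finite state \<Rightarrow> 'n state" where
  "negate \<alpha> = (\<chi> k. if \<alpha> $ k = 0 then 1 else 0)"

lemma disagreement_negate: "disagreement \<alpha> (negate g) = - disagreement \<alpha> g"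
  by (auto simp: disagreement_def negate_def)

lemma selected_negate: "selected (negate g) p \<longleftrightarrow> \<not> selected g p"
  by (auto simp: selected_def negate_def)

lemma negate_eq_iff: "negate g $ i = negate g $ j \<longleftrightarrow> g $ i = g $ j"
  by (auto simp: negate_def)

lemma selected_iff_disagreement:
  "selected \<alpha> p \<longleftrightarrow> (selected g p \<longleftrightarrow> fst p \<notin> disagreement \<alpha> g)"
  unfolding selected_def disagreement_def mem_Collect_eq not_not
  using bit_eq_via[of "\<alpha> $ fst p" "snd p" "g $ fst p"] by (auto simp: eq_commute)

text \<open>
  Any set of states that no arrow of the state graph leaves is such a family: the two conditions
  are the arrows for arcs of the patterns \<open>+ +\<close> and \<open>+ - +\<close>.
\<close>

locale closed_family = cyclic_word nxt for nxt :: "'n::finite \<times> bit \<Rightarrow> 'n \<times> bit" +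
  fixes C :: "'n state set"
  assumes closed_pair:
      "\<alpha> \<in> C \<Longrightarrow> selected \<alpha> p \<Longrightarrow> selected \<alpha> (nxt p) \<Longrightarrow> flip_at \<alpha> p \<in> C"
    and closed_skip:
      "\<alpha> \<in> C \<Longrightarrow> selected \<alpha> p \<Longrightarrow> \<not> selected \<alpha> (nxt p) \<Longrightarrow> selected \<alpha> (nxt (nxt p)) \<Longrightarrow>
        flip \<alpha> (fst p) (fst (nxt (nxt p))) \<in> C"
begin

text \<open>
  Changing the letters of a \<open>+ +\<close> pair is an arrow and changing those of a \<open>- -\<close> pair is a reversed
  arrow. Whether equal selection means equal or different bits depends on the positions.
\<close>

lemma adjacent_exchangeable:
  "exchangeable C (snd p \<noteq> snd (nxt p)) (fst p) (fst (nxt p))"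
  unfolding exchangeable_def
proof (intro ballI impI)
  fix \<alpha>
  assume "\<alpha> \<in> C" and "(\<alpha> $ fst p \<noteq> \<alpha> $ fst (nxt p)) = (snd p \<noteq> snd (nxt p))"
  then have eq: "selected \<alpha> p = selected \<alpha> (nxt p)"
    unfolding selected_def
    using bit_eq_swap[of "\<alpha> $ fst p" "\<alpha> $ fst (nxt p)" "snd p" "snd (nxt p)"] by blast
  show "flip_at \<alpha> p \<in> C"
  proof (cases "selected \<alpha> p")
    case True
    then show ?thesis
      using closed_pair \<open>\<alpha> \<in> C\<close> eq by simp
  next
    case False
    then have "\<not> selected \<alpha> (nxt p)"
      using eq by simp
    show ?thesis
      by (rule pair_flip_reversible[OF closed_pair]) (assumption | fact)+
  qed
qed

lemma some_exchangeable:
  assumes "i \<noteq> j"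
  shows "\<exists>d. exchangeable C d i j"
proof -
  \<comment> \<open>The positions of letters related to \<open>i\<close> form a set invariant under \<open>nxt\<close>.\<close>
  let ?Q = "{p :: 'n \<times> bit. fst p = i \<or> (\<exists>d. exchangeable C d i (fst p))}"
  have "?Q = UNIV"
  proof (rule single_cycle[of "(i, 0)"])
    fix q
    assume q: "q \<in> ?Q"
    consider "fst q = i" | "fst (nxt q) = i"
      | d where "fst q \<noteq> i" "fst (nxt q) \<noteq> i" "exchangeable C d i (fst q)"
      using q by blast
    then show "nxt q \<in> ?Q"
    proof cases
      case 1
      then show ?thesis using adjacent_exchangeable[of q] by auto
    next
      case 2
      then show ?thesis by simp
    next
      case 3
      then have "\<exists>d. exchangeable C d i (fst (nxt q))"
        using exchangeable_trans[OF 3(3) adjacent_exchangeable[of q]] reduced[of q] by metis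
      then show ?thesis by simp
    qed
  qed simp
  then have "(j, 0) \<in> ?Q"
    by blast
  then show ?thesis
    using assms by simp
qed

text \<open>
  A state \<open>g\<close> from which the signs of all permissions can be read off. In terms of signed graphs, it is
  a switching that makes all signs positive.
\<close>

definition balancing :: "'n state \<Rightarrow> bool" where
  "balancing g \<longleftrightarrow> (\<forall>i j. i \<noteq> j \<longrightarrow> exchangeable C (g $ i = g $ j) i j) \<and>
     (\<forall>p. selected g (nxt p) \<longleftrightarrow> \<not> selected g p)"

lemma balancing_negate: "balancing g \<Longrightarrow> balancing (negate g)"
  by (simp add: balancing_def negate_eq_iff selected_negate)

text \<open>
  If no pair carries both signs, then signs multiply along triangles. Measuring them from a base letter
  \<open>base\<close> yields \<open>g\<close>, and \<open>g\<close> alternates because the sign at neighbouring positions is known.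
\<close>

lemma balanced_or_complete:
  "(\<exists>g. balancing g) \<or> (\<forall>i j. i \<noteq> j \<longrightarrow> (\<forall>d. exchangeable C d i j))"
proof (cases "\<exists>i j. i \<noteq> j \<and> (\<forall>d. exchangeable C d i j)")
  case True
  then obtain i j where "i \<noteq> j" "\<And>d. exchangeable C d i j"
    by blast
  then have "exchangeable C d k l" if "k \<noteq> l" for d k l
    using exchangeable_both_spreads[OF some_exchangeable, where i = i and j = j] that by blast
  then show ?thesis
    by blast
next
  case False
  have unique: "d = e" if "exchangeable C d i j" "exchangeable C e i j" "i \<noteq> j" for d e i j
  proof (rule ccontr)
    assume "d \<noteq> e"
    have "exchangeable C c i j" for c
    proof -
      from \<open>d \<noteq> e\<close> have "c = d \<or> c = e" by auto
      with that show ?thesis by blast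
    qed
    then show False using False that by blast
  qed
  obtain base :: 'n where True by simp
  \<comment> \<open>The letters whose permission with the base letter is an exchange get the same bit as the base letter.\<close>
  define g :: "'n state" where "g = (\<chi> i. if i = base \<or> exchangeable C True base i then 0 else 1)"
  have base: "(g $ base = g $ i) = d" if "i \<noteq> base" "exchangeable C d base i" for i d
    using that unique[of True base i d] by (cases d) (auto simp: g_def)
  have g: "(g $ i = g $ j) = d" if ij: "i \<noteq> j" and d: "exchangeable C d i j" for i j d
  proof -
    consider "i = base" | "j = base" | "i \<noteq> base" "j \<noteq> base" by blast
    then show ?thesis
    proof cases
      case 1
      then show ?thesis using base that by auto
    next
      case 2
      then show ?thesis using base[of i d] exchangeable_sym[OF d] ij by auto
    next
      case 3
      obtain d1 d2 where d12: "exchangeable C d1 base i" "exchangeable C d2 base j"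
        using some_exchangeable 3 by metis
      then have "exchangeable C (d1 = d2) i j"
        using exchangeable_trans[OF exchangeable_sym] 3 ij by metis
      then have d: "d = (d1 = d2)"
        by (rule unique[OF d _ ij])
      have "(g $ i = g $ j) = ((g $ base = g $ i) = (g $ base = g $ j))"
        by (rule bit_eq_via)
      then show ?thesis
        unfolding base[OF 3(1) d12(1)] base[OF 3(2) d12(2)] d .
    qed
  qed
  have "balancing g"
    unfolding balancing_def
  proof (intro conjI allI impI)
    fix i j :: 'n
    assume "i \<noteq> j"
    then obtain d where d: "exchangeable C d i j"
      using some_exchangeable by blast
    show "exchangeable C (g $ i = g $ j) i j"
      unfolding g[OF \<open>i \<noteq> j\<close> d] by (rule d)
  next
    fix p
    have "(g $ fst p = g $ fst (nxt p)) = (snd p \<noteq> snd (nxt p))"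
      by (rule g[OF reduced[THEN not_sym] adjacent_exchangeable])
    then show "selected g (nxt p) \<longleftrightarrow> \<not> selected g p"
      unfolding selected_def using bit_eq_swap[of "g $ fst p" "g $ fst (nxt p)" "snd p" "snd (nxt p)"]
      by blast
  qed
  then show ?thesis by blast
qed

lemma balanced_level:
  assumes "balancing g" "\<alpha> \<in> C" "card (disagreement \<alpha> g) = card (disagreement \<beta> g)"
  shows "\<beta> \<in> C"
proof (rule exchange_closed_level[OF _ assms(2,3)])
  fix \<gamma> i j
  assume "\<gamma> \<in> C" "i \<noteq> j" "(\<gamma> $ i \<noteq> \<gamma> $ j) = (g $ i = g $ j)"
  moreover from \<open>i \<noteq> j\<close> have "exchangeable C (g $ i = g $ j) i j"
    using conjunct1[OF assms(1)[unfolded balancing_def]] by blast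
  ultimately show "flip \<gamma> i j \<in> C"
    by (simp only: exchangeable_def)
qed

text \<open>
  Choose three consecutive positions such that \<open>g\<close> selects the first one. Their letters are distinct;
  since at least three letters are free of disagreements, the disagreements can be moved
  away from these letters, and then the pattern is \<open>+ - +\<close> just as for \<open>g\<close>. The arrow for this arc
  creates two new disagreements.
\<close>

lemma balanced_level_up:
  assumes g: "balancing g" and "\<alpha> \<in> C" and room: "card (disagreement \<alpha> g) + 3 \<le> CARD('n)"
  shows "\<exists>\<beta>\<in>C. card (disagreement \<beta> g) = card (disagreement \<alpha> g) + 2"
proof -
  have alt: "selected g (nxt p) \<longleftrightarrow> \<not> selected g p" for p
    using g by (simp only: balancing_def)
  obtain p where p: "selected g p"
    using alt by blast
  let ?i = "fst p" and ?j = "fst (nxt p)" and ?k = "fst (nxt (nxt p))"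
  \<comment> \<open>Otherwise the circle would consist of two positions only.\<close>
  have "?i \<noteq> ?k"
  proof
    assume "?i = ?k"
    then have "nxt (nxt p) = p"
      using p alt unfolding selected_def by (metis prod.expand)
    then have all: "{p, nxt p} = UNIV"
      by (intro single_cycle[of p]) auto
    have "UNIV = {?i, ?j}"
    proof (rule UNIV_eq_I)
      fix a
      have "(a, 0) \<in> {p, nxt p}"
        unfolding all by simp
      then have "fst (a, 0 :: bit) \<in> fst ` {p, nxt p}"
        by (rule imageI)
      then show "a \<in> {?i, ?j}"
        by simp
    qed
    moreover have "card {?i, ?j} \<le> 2"
      by (simp add: card_insert_if)
    ultimately have "CARD('n) \<le> 2"
      by simp
    then show False
      using room by simp
  qed
  have "card (UNIV - {?i, ?j, ?k}) \<ge> card (disagreement \<alpha> g)"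
  proof -
    have "card {?i, ?j, ?k} \<le> 3"
      by (simp add: card_insert_if)
    then show ?thesis
      using room by (simp add: card_Diff_subset)
  qed
  then obtain D where D: "D \<subseteq> UNIV - {?i, ?j, ?k}" "card D = card (disagreement \<alpha> g)"
    by (meson obtain_subset_with_card_n)
  define \<beta> :: "'n state" where "\<beta> = (\<chi> k. if k \<in> D then (negate g) $ k else g $ k)"
  have dis: "disagreement \<beta> g = D"
    by (auto simp: disagreement_def \<beta>_def negate_def)
  have "\<beta> \<in> C"
    using balanced_level[OF g \<open>\<alpha> \<in> C\<close>] dis D by simp
  moreover have "selected \<beta> p" "\<not> selected \<beta> (nxt p)" "selected \<beta> (nxt (nxt p))"
    using D p alt by (auto simp: selected_iff_disagreement[of \<beta> _ g] dis)
  ultimately have "flip \<beta> ?i ?k \<in> C"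
    by (rule closed_skip)
  moreover have "disagreement (flip \<beta> ?i ?k) g = insert ?i (insert ?k D)"
    using D \<open>?i \<noteq> ?k\<close> by (auto simp: disagreement_flip dis)
  moreover have "card (insert ?i (insert ?k D)) = card D + 2"
  proof -
    have "?i \<notin> insert ?k D" "?k \<notin> D"
      using D \<open>?i \<noteq> ?k\<close> by auto
    then show ?thesis
      by simp
  qed
  ultimately show ?thesis
    using D by metis
qed

text \<open>
  Complementing \<open>g\<close> turns disagreements into agreements.
\<close>

lemma balanced_level_down:
  assumes g: "balancing g" and "\<alpha> \<in> C" and room: "3 \<le> card (disagreement \<alpha> g)"
  shows "\<exists>\<beta>\<in>C. card (disagreement \<beta> g) + 2 = card (disagreement \<alpha> g)"
proof -
  have compl: "card (disagreement \<gamma> (negate g)) = CARD('n) - card (disagreement \<gamma> g)"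
    "card (disagreement \<gamma> g) \<le> CARD('n)" for \<gamma>
    by (simp_all add: disagreement_negate card_complement card_mono)
  have "card (disagreement \<alpha> (negate g)) + 3 \<le> CARD('n)"
    using room compl[of \<alpha>] by linarith
  then obtain \<beta> where "\<beta> \<in> C"
    "card (disagreement \<beta> (negate g)) = card (disagreement \<alpha> (negate g)) + 2"
    using balanced_level_up[OF balancing_negate[OF g] \<open>\<alpha> \<in> C\<close>] by blast
  then show ?thesis
    using compl[of \<alpha>] compl[of \<beta>] room by (intro bexI[of _ \<beta>]) auto
qed

lemma balanced_covers:
  assumes g: "balancing g" and "\<alpha> \<in> C" and parity: "parity \<beta> = parity \<alpha>"
    and ends: "0 < card (disagreement \<beta> g)" "card (disagreement \<beta> g) < CARD('n)"
  shows "\<beta> \<in> C"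
proof -
  let ?L = "(\<lambda>\<alpha>. card (disagreement \<alpha> g)) ` C"
  let ?n = "card (disagreement \<beta> g)" and ?m = "card (disagreement \<alpha> g)"
  have par: "even ?n = even ?m"
    using parity parity_eq_iff_even_disagreement by blast
  have "?n \<in> ?L"
  proof (cases "?m \<le> ?n")
    case True
    have "?m + 2 * d \<le> ?n \<Longrightarrow> ?m + 2 * d \<in> ?L" for d
    proof (induction d)
      case 0
      show ?case using \<open>\<alpha> \<in> C\<close> by simp
    next
      case (Suc d)
      then obtain \<gamma> where "\<gamma> \<in> C" "card (disagreement \<gamma> g) = ?m + 2 * d"
        by auto
      moreover from this obtain \<delta> where "\<delta> \<in> C" "card (disagreement \<delta> g) = ?m + 2 * d + 2"
        using balanced_level_up[OF g, of \<gamma>] Suc.prems ends by auto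
      ultimately show ?case by (intro image_eqI[of _ _ \<delta>]) auto
    qed
    from this[of "(?n - ?m) div 2"] show ?thesis
      using True par by auto
  next
    case False
    have "d * 2 + ?n \<le> ?m \<Longrightarrow> ?m - 2 * d \<in> ?L" for d
    proof (induction d)
      case 0
      show ?case using \<open>\<alpha> \<in> C\<close> by simp
    next
      case (Suc d)
      then obtain \<gamma> where "\<gamma> \<in> C" "card (disagreement \<gamma> g) = ?m - 2 * d"
        by auto
      moreover have "3 \<le> ?m - 2 * d"
        using Suc.prems ends by simp
      ultimately obtain \<delta> where "\<delta> \<in> C" "card (disagreement \<delta> g) + 2 = ?m - 2 * d"
        using balanced_level_down[OF g, of \<gamma>] by metis
      then show ?case by (intro image_eqI[of _ _ \<delta>]) auto
    qed
    from this[of "(?m - ?n) div 2"] show ?thesis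
      using False par by auto
  qed
  then obtain \<gamma> where "\<gamma> \<in> C" "card (disagreement \<gamma> g) = ?n"
    by auto
  then show ?thesis
    by (rule balanced_level[OF g])
qed

text \<open>
  In the balanced case only \<open>g\<close> and its complement are left open. A predecessor of one of these
  disagrees with \<open>g\<close> at exactly two letters or at all but two, so it is not extreme and
  lies in \<open>C\<close>.
\<close>

theorem contains_states_with_predecessor:
  assumes card: "CARD('n) \<ge> 3" and "\<alpha> \<in> C" and parity: "parity \<beta> = parity \<alpha>"
    and pred: "\<beta> = flip \<delta> i j" "i \<noteq> j" and step: "\<delta> \<in> C \<Longrightarrow> \<beta> \<in> C"
  shows "\<beta> \<in> C"
proof -
  consider (balanced) g where "balancing g"
    | (complete) "\<And>i j d. i \<noteq> j \<Longrightarrow> exchangeable C d i j"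
    using balanced_or_complete by blast
  then show ?thesis
  proof cases
    case complete
    have "flip \<gamma> k l \<in> C" if "\<gamma> \<in> C" "k \<noteq> l" for \<gamma> k l
      using complete[OF that(2), of "\<gamma> $ k \<noteq> \<gamma> $ l"] that(1) unfolding exchangeable_def by blast
    then show ?thesis
      by (rule flip_closed_parity_class[OF _ \<open>\<alpha> \<in> C\<close> parity[symmetric]])
  next
    case balanced
    show ?thesis
    proof (cases "disagreement \<beta> g = {} \<or> disagreement \<beta> g = UNIV")
      case False
      then have "0 < card (disagreement \<beta> g)" "card (disagreement \<beta> g) < CARD('n)"
        by (auto simp: card_gt_0_iff intro!: psubset_card_mono)
      then show ?thesis
        using balanced_covers[OF balanced \<open>\<alpha> \<in> C\<close> parity] by blast
    next
      case True
      have "\<delta> = flip \<beta> i j"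
        using pred by simp
      then have "disagreement \<delta> g = {i, j} \<or> disagreement \<delta> g = - {i, j}"
        using True pred(2) by (auto simp: disagreement_flip)
      then have "card (disagreement \<delta> g) = card {i, j} \<or> card (disagreement \<delta> g) = card (- {i, j})"
        by (elim disjE) (simp_all only: simp_thms)
      moreover have "card {i, j} = 2"
        using pred(2) by simp
      ultimately have "card (disagreement \<delta> g) = 2 \<or> card (disagreement \<delta> g) = CARD('n) - 2"
        unfolding card_complement by (simp only:)
      then have "0 < card (disagreement \<delta> g)" "card (disagreement \<delta> g) < CARD('n)"
        using card by auto
      moreover have "parity \<delta> = parity \<alpha>"
        using parity pred by (simp add: parity_flip)
      ultimately have "\<delta> \<in> C"
        using balanced_covers[OF balanced \<open>\<alpha> \<in> C\<close>] by blast
      then show ?thesis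
        by (rule step)
    qed
  qed
qed

end

section \<open>Component structure\<close>

lemma reachable_iff_rtrancl:
  assumes "pverts A = UNIV"
  shows "u \<rightarrow>\<^sup>*\<^bsub>with_proj A\<^esub> v \<longleftrightarrow> (u, v) \<in> (parcs A)\<^sup>*"
proof
  assume "u \<rightarrow>\<^sup>*\<^bsub>with_proj A\<^esub> v"
  then show "(u, v) \<in> (parcs A)\<^sup>*"
    unfolding reachable_def with_proj_simps by (rule rtrancl_on_rtranclI)
next
  assume "(u, v) \<in> (parcs A)\<^sup>*"
  then show "u \<rightarrow>\<^sup>*\<^bsub>with_proj A\<^esub> v"
    unfolding reachable_def
    by (intro rtrancl_consistent_rtrancl_on) (simp_all add: assms)
qed

lemma in_degree_eq_0_iff:
  fixes A :: "'a::finite pair_pre_digraph"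
  shows "in_degree (with_proj A) v = 0 \<longleftrightarrow> (\<forall>u. (u, v) \<notin> parcs A)"
  by (force simp: in_degree_def in_arcs_def)

lemma out_degree_eq_0_iff:
  fixes A :: "'a::finite pair_pre_digraph"
  shows "out_degree (with_proj A) v = 0 \<longleftrightarrow> (\<forall>u. (v, u) \<notin> parcs A)"
  by (force simp: out_degree_def out_arcs_def)

text \<open>
  What remains of the state graph for its component structure: arrows respect parity, there are no sinks,
  and everything that has a predecessor is reached from its whole parity class.
\<close>

locale almost_strongly_connected =
  fixes A :: "'n::finite state pair_pre_digraph"
  assumes all_verts: "pverts A = UNIV"
    and arc_parity: "(\<alpha>, \<beta>) \<in> parcs A \<Longrightarrow> parity \<beta> = parity \<alpha>"
    and out_arc: "\<exists>\<beta>. (\<alpha>, \<beta>) \<in> parcs A"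
    and reaches: "parity \<alpha> = parity \<beta> \<Longrightarrow> (\<delta>, \<beta>) \<in> parcs A \<Longrightarrow> (\<alpha>, \<beta>) \<in> (parcs A)\<^sup>*"
begin

lemma source_states_iff: "\<alpha> \<in> source_states A \<epsilon> \<longleftrightarrow> parity \<alpha> = \<epsilon> \<and> (\<forall>\<delta>. (\<delta>, \<alpha>) \<notin> parcs A)"
  by (simp add: source_states_def parity_class_def in_degree_eq_0_iff)

lemma nonsource_states_iff: "\<alpha> \<in> nonsource_states A \<epsilon> \<longleftrightarrow> parity \<alpha> = \<epsilon> \<and> (\<exists>\<delta>. (\<delta>, \<alpha>) \<in> parcs A)"
  by (auto simp: nonsource_states_def source_states_iff parity_class_def)

lemma rtrancl_parity: "(\<alpha>, \<beta>) \<in> (parcs A)\<^sup>* \<Longrightarrow> parity \<beta> = parity \<alpha>"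
  by (induction rule: rtrancl_induct) (auto dest: arc_parity)

lemma source_reached_only_from_itself:
  "(\<alpha>, \<beta>) \<in> (parcs A)\<^sup>* \<Longrightarrow> \<beta> \<in> source_states A \<epsilon> \<Longrightarrow> \<alpha> = \<beta>"
  by (erule rtranclE) (auto simp: source_states_iff)

lemma sccs_verts_iff:
  "C \<in> pre_digraph.sccs_verts (with_proj A) \<longleftrightarrow>
    C \<noteq> {} \<and> (\<forall>u\<in>C. \<forall>v\<in>C. (u, v) \<in> (parcs A)\<^sup>*) \<and>
    (\<forall>u\<in>C. \<forall>v. v \<notin> C \<longrightarrow> (u, v) \<notin> (parcs A)\<^sup>* \<or> (v, u) \<notin> (parcs A)\<^sup>*)"
  unfolding pre_digraph.sccs_verts_def reachable_iff_rtrancl[OF all_verts] by blast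

lemma nonsource_states_scc: "nonsource_states A \<epsilon> \<in> pre_digraph.sccs_verts (with_proj A)"
  unfolding sccs_verts_iff
proof (intro conjI ballI allI impI)
  obtain \<alpha> :: "'n state" where "parity \<alpha> = \<epsilon>"
  proof -
    have "parity (axis i \<epsilon> :: 'n state) = \<epsilon>" for i
      by (simp add: parity_def axis_def)
    then show thesis using that by blast
  qed
  then show "nonsource_states A \<epsilon> \<noteq> {}"
    using out_arc[of \<alpha>] arc_parity nonsource_states_iff by blast
next
  fix u v
  assume "u \<in> nonsource_states A \<epsilon>" "v \<in> nonsource_states A \<epsilon>"
  then show "(u, v) \<in> (parcs A)\<^sup>*"
    using reaches nonsource_states_iff by metis
next
  fix u v
  assume "u \<in> nonsource_states A \<epsilon>" "v \<notin> nonsource_states A \<epsilon>"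
  then show "(u, v) \<notin> (parcs A)\<^sup>* \<or> (v, u) \<notin> (parcs A)\<^sup>*"
    using rtrancl_parity source_reached_only_from_itself source_states_iff nonsource_states_iff
    by metis
qed

lemma source_state_scc: "\<alpha> \<in> source_states A \<epsilon> \<Longrightarrow> {\<alpha>} \<in> pre_digraph.sccs_verts (with_proj A)"
  unfolding sccs_verts_iff using source_reached_only_from_itself by blast

lemma scc_unique:
  assumes "C \<in> pre_digraph.sccs_verts (with_proj A)" "D \<in> pre_digraph.sccs_verts (with_proj A)"
    and "u \<in> C" "u \<in> D"
  shows "C = D"
  using assms unfolding sccs_verts_iff by blast

lemma scc_cases:
  assumes "C \<in> pre_digraph.sccs_verts (with_proj A)" "C \<subseteq> parity_class \<epsilon>"
  obtains "C = nonsource_states A \<epsilon>" | \<alpha> where "\<alpha> \<in> source_states A \<epsilon>" "C = {\<alpha>}"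
proof -
  obtain u where "u \<in> C"
    using assms by (auto simp: sccs_verts_iff)
  then have "u \<in> nonsource_states A \<epsilon> \<or> u \<in> source_states A \<epsilon>"
    using assms by (auto simp: nonsource_states_def)
  then show thesis
    using that scc_unique[OF assms(1)] nonsource_states_scc source_state_scc \<open>u \<in> C\<close> by blast
qed

lemma nonsource_not_singleton_source:
  "\<alpha> \<in> source_states A \<epsilon> \<Longrightarrow> nonsource_states A \<epsilon> \<noteq> {\<alpha>}"
  by (auto simp: nonsource_states_def)

lemma condensation_arc_iff:
  "(C, D) \<in> parcs (condensation A) \<longleftrightarrow>
     C \<in> pre_digraph.sccs_verts (with_proj A) \<and> D \<in> pre_digraph.sccs_verts (with_proj A) \<and> C \<noteq> D \<and>
     (\<exists>u\<in>C. \<exists>v\<in>D. (u, v) \<in> parcs A)"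
  by (simp add: condensation_def)

lemma condensation_head:
  assumes arc: "(C, D) \<in> parcs (condensation A)" and "C \<subseteq> parity_class \<epsilon>"
  shows "D = nonsource_states A \<epsilon>"
proof -
  obtain u v where "u \<in> C" "v \<in> D" "(u, v) \<in> parcs A" and D: "D \<in> pre_digraph.sccs_verts (with_proj A)"
    using arc by (auto simp: condensation_arc_iff)
  moreover from this have "v \<in> nonsource_states A \<epsilon>"
    using assms(2) arc_parity by (auto simp: nonsource_states_iff parity_class_def)
  ultimately show ?thesis
    using scc_unique nonsource_states_scc by blast
qed

theorem scc_structure:
  "{C \<in> pre_digraph.sccs_verts A. C \<subseteq> parity_class \<epsilon>}
      = insert (nonsource_states A \<epsilon>) {{\<alpha>} | \<alpha>. \<alpha> \<in> source_states A \<epsilon>}" (is "?sccs = ?rhs")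
  "{C \<in> pverts (condensation A). C \<subseteq> parity_class \<epsilon> \<and> out_degree (condensation A) C = 0}
      = {nonsource_states A \<epsilon>}" (is "?sinks = _")
  "\<alpha> \<in> source_states A \<epsilon> \<Longrightarrow> in_degree (condensation A) {\<alpha>} = 0"
  "\<alpha> \<in> source_states A \<epsilon> \<Longrightarrow>
      out_arcs (condensation A) {\<alpha>} = {({\<alpha>}, nonsource_states A \<epsilon>)}"
proof -
  have N: "nonsource_states A \<epsilon> \<subseteq> parity_class \<epsilon>"
    by (auto simp: nonsource_states_def)
  have S: "{\<alpha>} \<subseteq> parity_class \<epsilon>" if "\<alpha> \<in> source_states A \<epsilon>" for \<alpha>
    using that by (auto simp: source_states_def)
  show sccs: "?sccs = ?rhs"
    using N S nonsource_states_scc source_state_scc by (blast elim: scc_cases)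
  have arc: "({\<alpha>}, nonsource_states A \<epsilon>) \<in> parcs (condensation A)" if \<alpha>: "\<alpha> \<in> source_states A \<epsilon>" for \<alpha>
  proof -
    obtain \<beta> where \<beta>: "(\<alpha>, \<beta>) \<in> parcs A"
      using out_arc by blast
    then have "\<beta> \<in> nonsource_states A \<epsilon>"
      using \<alpha> arc_parity by (auto simp: nonsource_states_iff source_states_iff)
    then show ?thesis
      using \<beta> nonsource_states_scc source_state_scc[OF \<alpha>] nonsource_not_singleton_source[OF \<alpha>]
      unfolding condensation_arc_iff by blast
  qed
  have "?sinks = {C \<in> ?sccs. \<forall>D. (C, D) \<notin> parcs (condensation A)}"
    by (auto simp: out_degree_eq_0_iff condensation_def)
  also have "\<dots> = {nonsource_states A \<epsilon>}"
  proof -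
    have "(nonsource_states A \<epsilon>, D) \<notin> parcs (condensation A)" for D
      using condensation_head[OF _ N] condensation_arc_iff by blast
    then show ?thesis
      unfolding sccs using arc by blast
  qed
  finally show "?sinks = {nonsource_states A \<epsilon>}" .
  show "in_degree (condensation A) {\<alpha>} = 0" if "\<alpha> \<in> source_states A \<epsilon>"
  proof -
    have "(C, {\<alpha>}) \<notin> parcs (condensation A)" for C
      using that unfolding condensation_arc_iff source_states_iff by blast
    then show ?thesis
      unfolding in_degree_eq_0_iff by blast
  qed
  show "out_arcs (condensation A) {\<alpha>} = {({\<alpha>}, nonsource_states A \<epsilon>)}" if "\<alpha> \<in> source_states A \<epsilon>"
  proof -
    have "({\<alpha>}, D) \<in> parcs (condensation A) \<longleftrightarrow> D = nonsource_states A \<epsilon>" for D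
      using arc[OF that] condensation_head[OF _ S[OF that]] by blast
    then have "{e \<in> parcs (condensation A). fst e = {\<alpha>}} = {({\<alpha>}, nonsource_states A \<epsilon>)}"
      by force
    then show ?thesis
      by (simp add: out_arcs_def)
  qed
qed

end

section \<open>Successors in cyclic order\<close>

lemma cyclic_next_in: "finite S \<Longrightarrow> S \<noteq> {} \<Longrightarrow> cyclic_next S t \<in> S"
  using Min_in[of "{u \<in> S. t < u}"] by (auto simp: cyclic_next_def)

lemma cyclic_next_neq:
  assumes "finite S" "u \<in> S" "u \<noteq> t"
  shows "cyclic_next S t \<noteq> t"
proof (cases "\<exists>u\<in>S. t < u")
  case True
  then have "Min {u \<in> S. t < u} \<in> {u \<in> S. t < u}"
    using assms(1) by (intro Min_in) auto
  then show ?thesis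
    using True by (auto simp: cyclic_next_def)
next
  case False
  then have "u < t"
    using assms(2,3) by force
  then have "Min S < t"
    using assms Min_le le_less_trans by blast
  then show ?thesis
    using False by (simp add: cyclic_next_def)
qed

text \<open>
  Thinning out a cyclically ordered set: the successor in the smaller set is found by stepping through the
  larger one until the smaller one is hit.
\<close>

lemma cyclic_next_subset:
  assumes "finite P" "S \<subseteq> P" "S \<noteq> {}"
  shows "cyclic_next S t =
    (if cyclic_next P t \<in> S then cyclic_next P t else cyclic_next S (cyclic_next P t))"
proof -
  have fin: "finite S"
    using assms finite_subset by blast
  show ?thesis
  proof (cases "\<exists>u\<in>P. t < u")
    case True
    define n where "n = cyclic_next P t"
    have n: "n = Min {u \<in> P. t < u}"
      using True by (simp add: n_def cyclic_next_def)
    have above: "{u \<in> S. t < u} = {u \<in> S. n \<le> u}"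
    proof -
      have "n \<in> {u \<in> P. t < u}"
        unfolding n using True assms(1) by (intro Min_in) auto
      moreover have "n \<le> u" if "u \<in> S" "t < u" for u
        unfolding n using that assms by (intro Min_le) auto
      ultimately show ?thesis
        by auto
    qed
    show ?thesis
    proof (cases "n \<in> S")
      case True
      then have "Min {u \<in> S. n \<le> u} = n"
        using fin by (intro Min_eqI) auto
      moreover have "\<exists>u\<in>S. t < u"
        using True above by blast
      ultimately show ?thesis
        using True above by (simp add: cyclic_next_def[of S] flip: n_def)
    next
      case False
      then have "{u \<in> S. n \<le> u} = {u \<in> S. n < u}"
        by (auto simp: le_less)
      then have eq: "{u \<in> S. t < u} = {u \<in> S. n < u}"
        using above by simp
      then have "(\<exists>u\<in>S. t < u) = (\<exists>u\<in>S. n < u)"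
        by blast
      then have "cyclic_next S t = cyclic_next S n"
        unfolding cyclic_next_def eq by simp
      then show ?thesis
        using False by (simp flip: n_def)
    qed
  next
    case False
    then have n: "cyclic_next P t = Min P" and t: "cyclic_next S t = Min S"
      using assms(2) by (auto simp: cyclic_next_def)
    show ?thesis
    proof (cases "Min P \<in> S")
      case True
      then have "Min S = Min P"
        using assms fin by (intro Min_eqI) (auto intro: Min_le)
      then show ?thesis
        using True n t by simp
    next
      case False
      then have "Min P < u" if "u \<in> S" for u
        using that assms Min_le[of P u] by (metis le_less subsetD)
      then have "{u \<in> S. Min P < u} = S" "\<exists>u\<in>S. Min P < u"
        using assms(3) by auto
      then have "cyclic_next S (Min P) = Min S"
        by (simp add: cyclic_next_def)
      then show ?thesis
        using False n t by simp
    qed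
  qed
qed

lemma cyclic_next_nth:
  assumes "sorted_wrt (<) L" "k < length L"
  shows "cyclic_next (set L) (L ! k) = L ! (Suc k mod length L)"
proof -
  have mono: "i < j \<Longrightarrow> j < length L \<Longrightarrow> L ! i < L ! j" for i j
    using assms(1) by (simp add: sorted_wrt_iff_nth_less)
  have mono_le: "i \<le> j \<Longrightarrow> j < length L \<Longrightarrow> L ! i \<le> L ! j" for i j
    using mono[of i j] by (cases "i = j") auto
  show ?thesis
  proof (cases "Suc k < length L")
    case True
    then have next_above: "L ! k < L ! Suc k"
      using mono by simp
    have "Min {u \<in> set L. L ! k < u} = L ! Suc k"
    proof (rule Min_eqI)
      fix u
      assume "u \<in> {u \<in> set L. L ! k < u}"
      then obtain j where j: "j < length L" "u = L ! j" "L ! k < L ! j"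
        by (auto simp: in_set_conv_nth)
      then have "k < j"
        using mono_le[of j k] assms(2) by (meson leD leI)
      then show "L ! Suc k \<le> u"
        using mono_le j by simp
    qed (use True next_above in auto)
    moreover have "\<exists>u\<in>set L. L ! k < u"
      using True next_above nth_mem by blast
    ultimately show ?thesis
      using True by (simp add: cyclic_next_def)
  next
    case False
    then have k: "Suc k = length L"
      using assms(2) by simp
    have "u \<le> L ! k" if "u \<in> set L" for u
      using that k mono_le by (auto simp: in_set_conv_nth)
    then have "\<not> (\<exists>u\<in>set L. L ! k < u)"
      by (meson leD)
    moreover have "Min (set L) = L ! 0"
    proof (rule Min_eqI)
      fix u
      assume "u \<in> set L"
      then show "L ! 0 \<le> u"
        using mono_le[of 0] by (auto simp: in_set_conv_nth)
    qed (use assms(2) in \<open>auto intro: nth_mem\<close>)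
    ultimately show ?thesis
      unfolding cyclic_next_def k by simp
  qed
qed

lemma cyclic_next_single_cycle:
  assumes "finite P" "t \<in> P" "t \<in> Q" and closed: "\<And>u. u \<in> Q \<inter> P \<Longrightarrow> cyclic_next P u \<in> Q"
  shows "P \<subseteq> Q"
proof
  fix v
  assume "v \<in> P"
  define L where "L = sorted_list_of_set P"
  let ?n = "length L"
  have L: "sorted_wrt (<) L" "set L = P"
    using assms(1) by (simp_all add: L_def)
  obtain i j where ij: "i < ?n" "t = L ! i" "j < ?n" "v = L ! j"
    using \<open>t \<in> P\<close> \<open>v \<in> P\<close> L(2) by (metis in_set_conv_nth)
  \<comment> \<open>Walk \<open>m\<close> steps from the position of \<open>t\<close>; the walk to \<open>v\<close> takes \<open>?n - i + j\<close> steps.\<close>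
  have "L ! ((i + m) mod ?n) \<in> Q" for m
  proof (induction m)
    case 0
    then show ?case
      using ij \<open>t \<in> Q\<close> by simp
  next
    case (Suc m)
    have lt: "(i + m) mod ?n < ?n"
      using ij by (intro mod_less_divisor) linarith
    then have "cyclic_next P (L ! ((i + m) mod ?n)) \<in> Q"
      using Suc.IH L(2) nth_mem by (intro closed) blast
    then show ?case
      using cyclic_next_nth[OF L(1) lt] L(2) by (simp add: mod_Suc_eq)
  qed
  from this[of "?n - i + j"] show "v \<in> Q"
    using ij by simp
qed

section \<open>Knot shadows\<close>

lemma periodic_int:
  fixes f :: "real \<Rightarrow> 'a"
  assumes "\<And>t. f (t + 1) = f t"
  shows "f (t + of_int k) = f t"
proof -
  have nat: "f (u + of_nat m) = f u" for u m
  proof (induction m)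
    case (Suc m)
    then show ?case
      using assms[of "u + of_nat m"] by (simp add: algebra_simps)
  qed simp
  show ?thesis
  proof (cases "k \<ge> 0")
    case True
    then show ?thesis
      using nat[of t "nat k"] by simp
  next
    case False
    then show ?thesis
      using nat[of "t + of_int k" "nat (- k)"] by simp
  qed
qed

text \<open>
  Counting preimages over one period gives the same result for every basepoint, so each crossing is
  passed exactly twice in the window of the traversal.
\<close>

lemma periodic_window_bij:
  fixes f :: "real \<Rightarrow> 'a"
  assumes "\<And>t. f (t + 1) = f t"
  shows "bij_betw frac {t \<in> {b..<b + 1}. f t = q} {t \<in> {0..<1}. f t = q}"
proof -
  have shift: "f (t - of_int k) = f t" for t k
    using periodic_int[of f t "- k", OF assms] by simp
  show ?thesis
  proof (rule bij_betw_byWitness[where f' = "\<lambda>u. b + frac (u - b)"])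
    show "\<forall>t\<in>{t \<in> {b..<b + 1}. f t = q}. b + frac (frac t - b) = t"
    proof
      fix t
      assume t: "t \<in> {t \<in> {b..<b + 1}. f t = q}"
      have "frac (frac t - b) = t - b"
        using t by (intro frac_unique_iff[THEN iffD2]) (auto simp: frac_def)
      then show "b + frac (frac t - b) = t"
        by simp
    qed
    show "\<forall>u\<in>{t \<in> {0..<1}. f t = q}. frac (b + frac (u - b)) = u"
    proof
      fix u
      assume u: "u \<in> {t \<in> {0..<1}. f t = q}"
      show "frac (b + frac (u - b)) = u"
        using u by (intro frac_unique_iff[THEN iffD2]) (auto simp: frac_def)
    qed
    show "frac ` {t \<in> {b..<b + 1}. f t = q} \<subseteq> {t \<in> {0..<1}. f t = q}"
      using shift by (auto simp: frac_lt_1) (simp add: frac_def)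
    show "(\<lambda>u. b + frac (u - b)) ` {t \<in> {0..<1}. f t = q} \<subseteq> {t \<in> {b..<b + 1}. f t = q}"
      using shift by (auto simp: frac_lt_1) (simp add: frac_def)
  qed
qed

locale reduced_shadow =
  fixes \<gamma> :: "real \<Rightarrow> real ^ 2" and b :: real and x :: "'n::finite \<Rightarrow> real ^ 2"
  assumes immersion: "generic_immersion \<gamma>"
    and labelling: "bij_betw x UNIV (crossings \<gamma>)"
    and word_reduced: "R1_reduced (occurrence_word \<gamma> b x)"
    and many_crossings: "CARD('n) > 3"
begin

definition passages :: "real set" where
  "passages = {t \<in> {b..<b + 1}. \<gamma> t \<in> crossings \<gamma>}"

definition point :: "'n \<times> bit \<Rightarrow> real" where
  "point p = occurrence \<gamma> b (x (fst p)) (snd p)"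

lemma card_preimages: "card {t \<in> {b..<b + 1}. \<gamma> t = x i} = 2"
proof -
  have "card {t \<in> {b..<b + 1}. \<gamma> t = x i} = card {t \<in> {0..<1}. \<gamma> t = x i}"
    by (rule bij_betw_same_card[OF periodic_window_bij[of \<gamma>]])
      (use immersion in \<open>simp add: generic_immersion_def\<close>)
  also have "\<dots> = 2"
    using immersion labelling by (auto simp: generic_immersion_def bij_betw_def)
  finally show ?thesis .
qed

lemma preimages_eq: "{t \<in> {b..<b + 1}. \<gamma> t = x i} = {point (i, 0), point (i, 1)}"
  and point_zero_less_one: "point (i, 0) < point (i, 1)"
proof -
  let ?T = "{t \<in> {b..<b + 1}. \<gamma> t = x i}"
  obtain s t where "?T = {s, t}" "s \<noteq> t"
    using card_preimages by (metis card_2_iff)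
  then obtain s t where T: "?T = {s, t}" "s < t"
    by (metis insert_commute linorder_neqE)
  have "point (i, 0) = s" "point (i, 1) = t"
    unfolding point_def occurrence_def fst_conv snd_conv Let_def T(1) using T(2) by simp_all
  with T show "?T = {point (i, 0), point (i, 1)}" "point (i, 0) < point (i, 1)"
    by simp_all
qed

lemma crossing_at_point: "\<gamma> (point p) = x (fst p)"
proof -
  have "point p \<in> {point (fst p, 0), point (fst p, 1)}"
    by (cases p; cases "snd p") auto
  then show ?thesis
    unfolding preimages_eq[symmetric] by simp
qed

lemma x_eq_iff: "x i = x j \<longleftrightarrow> i = j"
  using labelling by (auto simp: bij_betw_def inj_eq)

lemma inj_point: "inj point"
proof (rule injI)
  fix p q
  assume eq: "point p = point q"
  then have fst: "fst p = fst q"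
    using crossing_at_point x_eq_iff by metis
  have "snd p = snd q"
  proof (rule ccontr)
    assume "snd p \<noteq> snd q"
    then have "{point p, point q} = {point (fst p, 0), point (fst p, 1)}"
      using fst by (cases p; cases q; cases "snd p"; cases "snd q") auto
    then show False
      using eq point_zero_less_one[of "fst p"] by (metis insert_absorb2 insertI1 insert_commute less_irrefl singletonD)
  qed
  with fst show "p = q"
    by (rule prod_eqI)
qed

lemma range_point: "range point = passages"
proof
  show "range point \<subseteq> passages"
  proof (clarify)
    fix i k
    have "point (i, k) \<in> {t \<in> {b..<b + 1}. \<gamma> t = x i}"
      unfolding preimages_eq by (cases k) auto
    then show "point (i, k) \<in> passages"
      using labelling by (auto simp: passages_def bij_betw_def)
  qed
  show "passages \<subseteq> range point"
  proof
    fix t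
    assume "t \<in> passages"
    moreover from this obtain i where "\<gamma> t = x i"
      using labelling by (auto simp: passages_def bij_betw_def)
    ultimately have "t \<in> {point (i, 0), point (i, 1)}"
      unfolding preimages_eq[symmetric] by (simp add: passages_def)
    then show "t \<in> range point"
      by blast
  qed
qed

lemma finite_passages: "finite passages"
  unfolding range_point[symmetric] by simp

definition successor :: "'n \<times> bit \<Rightarrow> 'n \<times> bit" where
  "successor p = inv point (cyclic_next passages (point p))"

lemma point_successor: "point (successor p) = cyclic_next passages (point p)"
proof -
  have "cyclic_next passages (point p) \<in> range point"
    unfolding range_point using finite_passages by (rule cyclic_next_in) (use range_point in auto)
  then show ?thesis
    unfolding successor_def by (rule f_inv_into_f)
qed

lemma successor_changes_label: "fst (successor p) \<noteq> fst p"
proof -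
  let ?L = "sorted_list_of_set passages"
  have L: "sorted_wrt (<) ?L" "set ?L = passages"
    using finite_passages by simp_all
  have label: "inv x (\<gamma> (point q)) = fst q" for q
    unfolding crossing_at_point using labelling by (simp add: bij_betw_def)
  obtain k where k: "k < length ?L" "point p = ?L ! k"
    using range_point L(2) by (metis in_set_conv_nth rangeI)
  then have succ: "point (successor p) = ?L ! (Suc k mod length ?L)"
    using cyclic_next_nth[OF L(1)] L(2) by (simp add: point_successor)
  have word: "occurrence_word \<gamma> b x = map (\<lambda>t. inv x (\<gamma> t)) ?L"
    by (simp add: occurrence_word_def passages_def)
  have "Suc k mod length ?L < length ?L"
    using k(1) by (intro mod_less_divisor) linarith
  moreover have "occurrence_word \<gamma> b x ! k \<noteq> occurrence_word \<gamma> b x ! (Suc k mod length ?L)"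
    using word_reduced k(1) unfolding R1_reduced_def word length_map by blast
  ultimately have "inv x (\<gamma> (?L ! k)) \<noteq> inv x (\<gamma> (?L ! (Suc k mod length ?L)))"
    using k(1) unfolding word by (simp only: nth_map not_False_eq_True)
  then show ?thesis
    unfolding k(2)[symmetric] succ[symmetric] label by simp
qed

sublocale cyclic_word successor
proof
  fix p :: "'n \<times> bit" and Q
  assume "p \<in> Q" and closed: "\<And>q. q \<in> Q \<Longrightarrow> successor q \<in> Q"
  have "passages \<subseteq> point ` Q"
  proof (rule cyclic_next_single_cycle[OF finite_passages, of "point p"])
    show "cyclic_next passages u \<in> point ` Q" if u: "u \<in> point ` Q \<inter> passages" for u
    proof -
      obtain q where "q \<in> Q" "u = point q"
        using u by blast
      then have "cyclic_next passages u = point (successor q)"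
        by (simp add: point_successor)
      then show ?thesis
        using closed[OF \<open>q \<in> Q\<close>] by simp
    qed
  qed (use \<open>p \<in> Q\<close> range_point in auto)
  then have "point q \<in> point ` Q" for q
    unfolding range_point[symmetric] by blast
  then show "Q = UNIV"
    unfolding inj_image_mem_iff[OF inj_point] by blast
next
  show "fst (successor p) \<noteq> fst p" for p
    by (rule successor_changes_label)
qed

lemma Sel_eq: "Sel \<gamma> b x \<alpha> = point ` {p. selected \<alpha> p}"
proof -
  have "{p. selected \<alpha> p} = range (\<lambda>i. (i, \<alpha> $ i))"
    by (auto simp: selected_def)
  then show ?thesis
    by (simp add: Sel_def point_def image_image)
qed

lemma finite_Sel: "finite (Sel \<gamma> b x \<alpha>)"
  by (simp add: Sel_def)

lemma Sel_nonempty: "Sel \<gamma> b x \<alpha> \<noteq> {}"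
  by (simp add: Sel_def)

lemma arc_end_exists: "\<exists>q. cyclic_next (Sel \<gamma> b x \<alpha>) (point p) = point q"
proof -
  have "cyclic_next (Sel \<gamma> b x \<alpha>) (point p) \<in> Sel \<gamma> b x \<alpha>"
    by (rule cyclic_next_in[OF finite_Sel Sel_nonempty])
  then show ?thesis
    unfolding Sel_eq by blast
qed

text \<open>
  An arc joins different crossings because a state with more than one crossing has
  more than one selected occurrence, one for each crossing.
\<close>

lemma arc_end_label:
  assumes "selected \<alpha> p" and q: "cyclic_next (Sel \<gamma> b x \<alpha>) (point p) = point q"
  shows "fst p \<noteq> fst q"
proof
  assume same: "fst p = fst q"
  let ?S = "Sel \<gamma> b x \<alpha>"
  have "point q \<in> ?S"
    unfolding q[symmetric] by (rule cyclic_next_in[OF finite_Sel Sel_nonempty])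
  then have "selected \<alpha> q"
    unfolding Sel_eq inj_image_mem_iff[OF inj_point] by simp
  with same assms(1) have "q = p"
    by (intro prod_eqI) (simp_all add: selected_def)
  obtain i where "i \<noteq> fst p"
  proof -
    have "(UNIV :: 'n set) \<noteq> {fst p}"
    proof
      assume "(UNIV :: 'n set) = {fst p}"
      then have "CARD('n) = card {fst p}"
        by (rule arg_cong)
      then show False
        using many_crossings by simp
    qed
    then show thesis
      using that by blast
  qed
  then have "(i, \<alpha> $ i) \<noteq> p"
    by auto
  then have "point (i, \<alpha> $ i) \<noteq> point p"
    unfolding inj_eq[OF inj_point] .
  moreover have "point (i, \<alpha> $ i) \<in> ?S"
    unfolding Sel_eq inj_image_mem_iff[OF inj_point] by (simp add: selected_def)
  ultimately have "cyclic_next ?S (point p) \<noteq> point p"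
    by (intro cyclic_next_neq[OF finite_Sel])
  then show False
    using q \<open>q = p\<close> by simp
qed

lemma state_graph_arc_iff:
  "(\<alpha>, \<beta>) \<in> parcs (state_graph \<gamma> b x) \<longleftrightarrow>
    (\<exists>p q. selected \<alpha> p \<and> cyclic_next (Sel \<gamma> b x \<alpha>) (point p) = point q \<and>
      \<beta> = flip \<alpha> (fst p) (fst q))" (is "?lhs \<longleftrightarrow> ?rhs")
proof
  assume ?lhs
  then obtain i j p where \<beta>: "\<beta> = \<alpha> + axis i 1 + axis j 1" and p: "selected \<alpha> p" "\<gamma> (point p) = x i"
    "\<gamma> (cyclic_next (Sel \<gamma> b x \<alpha>) (point p)) = x j"
    by (auto simp: state_graph_def state_arcs_def Sel_eq)
  obtain q where q: "cyclic_next (Sel \<gamma> b x \<alpha>) (point p) = point q"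
    using arc_end_exists by blast
  have "i = fst p" "j = fst q"
    using p q by (simp_all add: crossing_at_point x_eq_iff)
  then have "\<beta> = flip \<alpha> (fst p) (fst q)"
    unfolding \<beta> by (simp only: flip_eq_add_axis[OF arc_end_label[OF p(1) q]])
  then show ?rhs
    using p(1) q by blast
next
  assume ?rhs
  then obtain p q where pq: "selected \<alpha> p" "cyclic_next (Sel \<gamma> b x \<alpha>) (point p) = point q"
    "\<beta> = flip \<alpha> (fst p) (fst q)"
    by blast
  have "\<beta> = \<alpha> + axis (fst p) 1 + axis (fst q) 1"
    unfolding pq(3) flip_eq_add_axis[OF arc_end_label[OF pq(1,2)]] by (rule refl)
  moreover have "(point p, point q) \<in> state_arcs \<gamma> b x \<alpha>"
    using pq(1,2) by (force simp: state_arcs_def Sel_eq)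
  then have "\<exists>(t, u)\<in>state_arcs \<gamma> b x \<alpha>. \<gamma> t = x (fst p) \<and> \<gamma> u = x (fst q)"
    using crossing_at_point by blast
  ultimately show ?lhs
    unfolding state_graph_def by auto
qed

lemma state_graph_arcE:
  assumes "(\<alpha>, \<beta>) \<in> parcs (state_graph \<gamma> b x)"
  obtains i j where "i \<noteq> j" "\<beta> = flip \<alpha> i j"
  using assms arc_end_label unfolding state_graph_arc_iff by blast

lemma cyclic_next_Sel:
  "cyclic_next (Sel \<gamma> b x \<alpha>) (point q) =
    (if selected \<alpha> (successor q) then point (successor q)
     else cyclic_next (Sel \<gamma> b x \<alpha>) (point (successor q)))"
proof -
  have "Sel \<gamma> b x \<alpha> \<subseteq> passages"
    unfolding Sel_eq range_point[symmetric] by blast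
  moreover note Sel_nonempty
  moreover have "point r \<in> Sel \<gamma> b x \<alpha> \<longleftrightarrow> selected \<alpha> r" for r
    by (simp add: Sel_eq inj_image_mem_iff[OF inj_point])
  ultimately show ?thesis
    using cyclic_next_subset[OF finite_passages, of "Sel \<gamma> b x \<alpha>" "point q"]
    unfolding point_successor[symmetric] by simp
qed

lemma arc_of_adjacent_pair:
  assumes "selected \<alpha> p" "selected \<alpha> (successor p)"
  shows "(\<alpha>, flip_at \<alpha> p) \<in> parcs (state_graph \<gamma> b x)"
  unfolding state_graph_arc_iff
proof (intro exI conjI)
  show "cyclic_next (Sel \<gamma> b x \<alpha>) (point p) = point (successor p)"
    using assms(2) cyclic_next_Sel[of \<alpha> p] by simp
qed (use assms(1) in simp_all)

lemma arc_skipping_one: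
  assumes "selected \<alpha> p" "\<not> selected \<alpha> (successor p)" "selected \<alpha> (successor (successor p))"
  shows "(\<alpha>, flip \<alpha> (fst p) (fst (successor (successor p)))) \<in> parcs (state_graph \<gamma> b x)"
  unfolding state_graph_arc_iff
proof (intro exI conjI)
  show "cyclic_next (Sel \<gamma> b x \<alpha>) (point p) = point (successor (successor p))"
    using assms(2,3) cyclic_next_Sel[of \<alpha> p] cyclic_next_Sel[of \<alpha> "successor p"]
    by simp
qed (use assms(1) in simp_all)

sublocale almost_strongly_connected "state_graph \<gamma> b x"
proof
  let ?A = "state_graph \<gamma> b x"
  show "pverts ?A = UNIV"
    by (simp add: state_graph_def)
  show "parity \<beta> = parity \<alpha>" if "(\<alpha>, \<beta>) \<in> parcs ?A" for \<alpha> \<beta>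
    using that by (elim state_graph_arcE) (simp add: parity_flip)
  show "\<exists>\<beta>. (\<alpha>, \<beta>) \<in> parcs ?A" for \<alpha>
  proof -
    have "selected \<alpha> (i, \<alpha> $ i)" for i
      by (simp add: selected_def)
    then show ?thesis
      unfolding state_graph_arc_iff using arc_end_exists by blast
  qed
  fix \<alpha> \<beta> \<delta> :: "'n state"
  assume parity: "parity \<alpha> = parity \<beta>" and pred: "(\<delta>, \<beta>) \<in> parcs ?A"
  \<comment> \<open>The states reachable from \<open>\<alpha>\<close> are closed under arrows.\<close>
  interpret closed_family successor "(parcs ?A)\<^sup>* `` {\<alpha>}"
  proof
    fix \<zeta> p
    assume "\<zeta> \<in> (parcs ?A)\<^sup>* `` {\<alpha>}" and p: "selected \<zeta> p"
    then have reach: "(\<alpha>, \<zeta>) \<in> (parcs ?A)\<^sup>*"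
      by simp
    show "flip_at \<zeta> p \<in> (parcs ?A)\<^sup>* `` {\<alpha>}" if "selected \<zeta> (successor p)"
      using rtrancl_into_rtrancl[OF reach arc_of_adjacent_pair[OF p that]] by simp
    show "flip \<zeta> (fst p) (fst (successor (successor p))) \<in> (parcs ?A)\<^sup>* `` {\<alpha>}"
      if "\<not> selected \<zeta> (successor p)" "selected \<zeta> (successor (successor p))"
      using rtrancl_into_rtrancl[OF reach arc_skipping_one[OF p that]] by simp
  qed
  obtain i j where ij: "i \<noteq> j" "\<beta> = flip \<delta> i j"
    using pred by (rule state_graph_arcE)
  have step: "\<beta> \<in> (parcs ?A)\<^sup>* `` {\<alpha>}" if "\<delta> \<in> (parcs ?A)\<^sup>* `` {\<alpha>}"
    using that rtrancl_into_rtrancl[OF _ pred, of \<alpha>] by simp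
  have "\<beta> \<in> (parcs ?A)\<^sup>* `` {\<alpha>}"
    by (rule contains_states_with_predecessor[of \<alpha>, OF _ _ _ ij(2,1) step])
      (use many_crossings parity in simp_all)
  then show "(\<alpha>, \<beta>) \<in> (parcs ?A)\<^sup>*"
    by simp
qed

text \<open>
  Changing both letters of a \<open>- -\<close> pair gives a predecessor.
\<close>

lemma source_state_has_no_unselected_pair:
  assumes "\<alpha> \<in> source_states (state_graph \<gamma> b x) \<epsilon>"
  shows "selected \<alpha> p \<or> selected \<alpha> (successor p)"
proof (rule ccontr)
  assume "\<not> (selected \<alpha> p \<or> selected \<alpha> (successor p))"
  then have "selected (flip_at \<alpha> p) p" "selected (flip_at \<alpha> p) (successor p)"
    using selected_flip_at by blast+
  then have "(flip_at \<alpha> p, flip_at (flip_at \<alpha> p) p) \<in> parcs (state_graph \<gamma> b x)"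
    by (rule arc_of_adjacent_pair)
  then show False
    using assms by (simp add: source_states_iff)
qed

lemma card_source_sccs:
  "card {{\<alpha>} | \<alpha>. \<alpha> \<in> source_states (state_graph \<gamma> b x) 0 \<union> source_states (state_graph \<gamma> b x) 1} \<le> 2"
proof -
  let ?S = "source_states (state_graph \<gamma> b x) 0 \<union> source_states (state_graph \<gamma> b x) 1"
  let ?X = "{\<alpha>. \<forall>p. selected \<alpha> p \<or> selected \<alpha> (successor p)}"
  have "?S \<subseteq> ?X"
    using source_state_has_no_unselected_pair by blast
  then have "card ?S \<le> card ?X"
    by (rule card_mono[OF finite])
  also have "\<dots> \<le> 2"
    by (rule card_alternating_le)
  finally have "card ?S \<le> 2" .
  have singletons: "{{\<alpha>} | \<alpha>. \<alpha> \<in> ?S} = (\<lambda>\<alpha>. {\<alpha>}) ` ?S"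
    by blast
  show ?thesis
    unfolding singletons using card_image_le[OF finite] \<open>card ?S \<le> 2\<close> by (rule le_trans)
qed

end

theorem theorem3p1:
  fixes \<gamma> :: "real \<Rightarrow> real ^ 2" and b :: real and x :: "'n::finite \<Rightarrow> real ^ 2"
    and W :: "'n list" and A :: "'n state pair_pre_digraph"
  assumes "generic_immersion \<gamma>"
    and "bij_betw x UNIV (crossings \<gamma>)"
    and "\<gamma> b \<notin> crossings \<gamma>"
    and "CARD('n) > 3"
    and "W = occurrence_word \<gamma> b x"
    and "R1_reduced W"
    and "A = state_graph \<gamma> b x"
  shows "(\<forall>\<epsilon>.
            {C \<in> pre_digraph.sccs_verts A. C \<subseteq> parity_class \<epsilon>}
              = insert (nonsource_states A \<epsilon>) {{\<alpha>} | \<alpha>. \<alpha> \<in> source_states A \<epsilon>} \<and>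
            {C \<in> pverts (condensation A). C \<subseteq> parity_class \<epsilon> \<and> out_degree (condensation A) C = 0}
              = {nonsource_states A \<epsilon>} \<and>
            (\<forall>\<alpha> \<in> source_states A \<epsilon>.
               in_degree (condensation A) {\<alpha>} = 0 \<and>
               out_arcs (condensation A) {\<alpha>} = {({\<alpha>}, nonsource_states A \<epsilon>)})) \<and>
         card {{\<alpha>} | \<alpha>. \<alpha> \<in> source_states A 0 \<union> source_states A 1} \<le> 2"
proof -
  interpret reduced_shadow \<gamma> b x
    using assms by unfold_locales simp_all
  show ?thesis
    unfolding \<open>A = state_graph \<gamma> b x\<close>
    by (intro conjI allI ballI scc_structure card_source_sccs)
qed

end
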